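(* Let $\phi_{\mathfrak{m}}$ denote the $\phi$-mixing coefficient of the sequence of continued fraction digits $(a_n)_{n\in\mathbb{N}}$ with respect to the Gauss measure $\mathfrak{m}$. Then $$\phi_{\mathfrak{m}}(1)=-\frac{1-\log 2+\log\log 2}{\log 2}<0.0861.$$
   Context: $I=[0,1)$ with its Borel $\sigma$-algebra. The Gauss map $G:I\to I$ is $G(\omega)=1/\omega-\lfloor 1/\omega\rfloor$ for $\omega\neq0$ and $G(0)=0$. The continued fraction digits are $a_n(\omega)=\lfloor 1/G^{n-1}(\omega)\rfloor$, $n\in\mathbb{N}=\{1,2,\dots\}$, defined for all irrational $\omega\in I$ (hence almost everywhere). $\mathfrak{m}$ denotes the Gauss measure on $I$, i.e. the $G$-invariant probability measure with Lebesgue density $h(x)=1/((x+1)\log 2)$. For two sub-$\sigma$-fields $\mathcal{C},\mathcal{D}$ of a probability space $(\Omega,\mathcal{A},\mathbb{P})$ put $$\phi(\mathcal{C},\mathcal{D}):=\sup\left\{\left|\mathbb{P}(D\mid C)-\mathbb{P}(D)\right| : C\in\mathcal{C},\ D\in\mathcal{D},\ \mathbb{P}(C)>0\right\}.$$ For a sequence of random variables $(X_n)_{n\in\mathbb{N}}$ the $\phi$-mixing coefficients are $$\phi(n):=\sup_{k\in\mathbb{N}}\phi\big(\sigma(X_j:1\le j\le k),\ \sigma(X_j: j\ge k+n)\big),\qquad n\in\mathbb{N}.$$ $\phi_{\mathfrak{m}}(n)$ is this coefficient for $X_j=a_j$ and $\mathbb{P}=\mathfrak{m}$. *)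

theory Defs
  imports "HOL-Probability.Probability"
begin

text \<open>
  The real-valued suprema below are over nonempty sets; for a probability space \<open>M\<close> and
  sub-\<open>\<sigma>\<close>-fields \<open>\<C>\<close>, \<open>\<D>\<close> they are bounded by 1.
\<close>

definition phi_dep :: "'a measure \<Rightarrow> 'a set set \<Rightarrow> 'a set set \<Rightarrow> real" where
  "phi_dep M \<C> \<D> =
     Sup {\<bar>\<P>(\<omega> in M. \<omega> \<in> D \<bar> \<omega> \<in> C) - measure M D\<bar> | C D.
            C \<in> \<C> \<and> D \<in> \<D> \<and> measure M C > 0}"

text \<open>The \<open>\<sigma>\<close>-field on \<open>space M\<close> generated by the \<open>N\<close>-valued variables \<open>X j\<close>, \<open>j \<in> J\<close>.\<close>

definition sigma_field_of ::
    "'a measure \<Rightarrow> 'b measure \<Rightarrow> (nat \<Rightarrow> 'a \<Rightarrow> 'b) \<Rightarrow> nat set \<Rightarrow> 'a set set" where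
  "sigma_field_of M N X J =
     sigma_sets (space M) {X j -` A \<inter> space M | j A. j \<in> J \<and> A \<in> sets N}"

text \<open>Sequences are indexed by \<open>j \<ge> 1\<close>; the value \<open>X 0\<close> is never used when \<open>n \<ge> 1\<close>.\<close>

definition phi_mixing ::
    "'a measure \<Rightarrow> 'b measure \<Rightarrow> (nat \<Rightarrow> 'a \<Rightarrow> 'b) \<Rightarrow> nat \<Rightarrow> real" where
  "phi_mixing M N X n =
     (SUP k\<in>{1..}. phi_dep M (sigma_field_of M N X {1..k}) (sigma_field_of M N X {k + n..}))"

definition gauss_map :: "real \<Rightarrow> real" where
  "gauss_map x = (if x = 0 then 0 else 1 / x - of_int \<lfloor>1 / x\<rfloor>)"

text \<open>
  For rational \<open>x\<close> the orbit reaches 0, from where on the digits are 0 because \<open>1 / 0 = 0\<close>.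
  This extension from the irrationals to a null set does not affect the mixing coefficients.
\<close>

definition cf_digit :: "nat \<Rightarrow> real \<Rightarrow> int" where
  "cf_digit n x = \<lfloor>1 / (gauss_map ^^ (n - 1)) x\<rfloor>"

definition gauss_measure :: "real measure" where
  "gauss_measure =
     density (restrict_space lborel {0..<1}) (\<lambda>x. ennreal (1 / ((x + 1) * ln 2)))"

definition phi_gauss :: "nat \<Rightarrow> real" where
  "phi_gauss n = phi_mixing gauss_measure (count_space UNIV) cf_digit n"

lemma space_gauss_measure: "space gauss_measure = {0..<1}"
  by (simp add: gauss_measure_def space_restrict_space)

lemma sets_gauss_measure: "sets gauss_measure = sets (restrict_space borel {0..<1})"
  by (simp add: gauss_measure_def sets_restrict_space)

lemma prob_space_gauss_measure: "prob_space gauss_measure"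
proof
  have deriv: "DERIV (\<lambda>x. ln (x + 1) / ln 2) x :> 1 / ((x + 1) * ln 2)" if "0 \<le> x" for x :: real
  proof -
    have "DERIV (\<lambda>x. ln (x + 1)) x :> 1 / (x + 1)"
      using that by (auto intro!: derivative_eq_intros)
    from DERIV_cdivide[OF this, of "ln 2"] show ?thesis
      by (simp only: divide_divide_eq_left)
  qed
  have "emeasure gauss_measure (space gauss_measure)
      = (\<integral>\<^sup>+x. ennreal (1 / ((x + 1) * ln 2)) \<partial>restrict_space lborel {0..<1})"
    unfolding gauss_measure_def
    by (subst emeasure_density)
       (auto intro!: nn_integral_cong measurable_restrict_space1 simp: space_restrict_space sets_restrict_space image_iff intro: exI[of _ "{0..<1}"])
  also have "\<dots> = (\<integral>\<^sup>+x. ennreal (1 / ((x + 1) * ln 2)) * indicator {0..<1} x \<partial>lborel)"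
    by (subst nn_integral_restrict_space) auto
  also have "\<dots> = (\<integral>\<^sup>+x. ennreal (1 / ((x + 1) * ln 2)) * indicator {0..1} x \<partial>lborel)"
    by (intro nn_integral_cong_AE AE_I[where N = "{1}"]) (auto split: split_indicator)
  also have "\<dots> = ennreal (ln (1 + 1) / ln 2 - ln (0 + 1) / ln 2)"
    by (rule nn_integral_FTC_Icc) (auto intro!: deriv)
  also have "\<dots> = 1"
    by simp
  finally show "emeasure gauss_measure (space gauss_measure) = 1" .
qed

lemma measurable_gauss_map [measurable]: "gauss_map \<in> borel_measurable borel"
  unfolding gauss_map_def by measurable

lemma measurable_cf_digit: "cf_digit n \<in> measurable gauss_measure (count_space UNIV)"
proof -
  have "(gauss_map ^^ k) \<in> borel_measurable borel" for k
    by (induction k) (auto intro: measurable_comp[OF _ measurable_gauss_map])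
  then have "cf_digit n \<in> measurable borel (count_space UNIV)"
    unfolding cf_digit_def by measurable
  then have "cf_digit n \<in> measurable (restrict_space borel {0..<1}) (count_space UNIV)"
    by (rule measurable_restrict_space1)
  then show ?thesis
    by (simp add: measurable_cong_sets[OF sets_gauss_measure refl])
qed

end

theory Submission
  imports Defs "HOL-Real_Asymp.Real_Asymp"
begin

text \<open>
  For $u \in [0,1]$ let $f_u(t) = (1 + ut)^{-2}$ on $[0,1)$. These kernels have two properties:

    \<^item> The Gauss density is their uniform mixture,
      $\frac{1}{(1+t)\log 2} = \frac{1}{\log 2}\int_0^1 f_u(t)\,du$.
    \<^item> The substitution $x = 1/(b+t)$ on the branch of the Gauss map with first digit $b$ maps
      the family to itself:
      $f_u(1/(b+t))\,(b+t)^{-2} = (b+u)^{-2} f_{1/(b+u)}(t)$.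

  So if $\omega$ has density proportional to some $f_u$, then conditionally on the digits
  $a_1,\dots,a_k$ the point $G^k\omega$ has density $(1+v) f_v$ for some $v \in [0,1]$. It follows
  that, for $C$ determined by the first $k$ digits, the law of $G^k\omega$ given $C$ under the Gauss
  measure is a mixture of the laws with density $(1+v) f_v$. Every event of the future
  $\sigma$-field is $G^{-k}E$ for a Borel set $E$ and has probability $\mathfrak{m}(E)$ by
  invariance. Hence $|\mathfrak{m}(D \mid C) - \mathfrak{m}(D)|$ is at most the largest total
  variation distance between the law with density $(1+v) f_v$ and $\mathfrak{m}$.

  Let $F_v(x) = (1+v)x/(1+vx)$ be the distribution function of that law, $H$ that of
  $\mathfrak{m}$, and $\delta$ the constant of the theorem. For $v \le 1/3$ the ratio of the
  densities is increasing and the distance is $\max_x\,(H - F_v)(x) \le \max_x\,(H(x) - x) = \delta$.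
  For $v \ge 1/2$ it is decreasing and the distance is
  $\max_x\,(F_v - H)(x) \le \max_x\,(2x/(1+x) - H(x)) = \delta$. In between the ratio is at most
  $\frac32 \log 2$, and $\frac32 \log 2 - 1$ is less than $\delta$. This gives the upper bound
  (lemmas \<open>excess_le\<close>, \<open>moebius_integral_cylinder_le\<close>, \<open>gauss_conditional_abs_le\<close>).

  For the lower bound (lemma \<open>phi_const_le_phi_dep\<close>) take $k = 1$ and $C = \{a_1 = b\}$. As
  $b \to \infty$, the law of $G\omega$ given $C$ tends to the uniform one, and the maximum of
  $H(x) - x$ is attained at $\xi = 1/\log 2 - 1$; so $D = \{G\omega < \xi\}$ yields the limit $\delta$.
  This $D$ lies in the $\sigma$-field of the digits from the second on, because $G\omega$ is the limit
  of its convergents, which are functions of these digits.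
\<close>

section \<open>Integration over the branches of the Gauss map\<close>

lemma nn_integral_inverse_shift:
  fixes f :: "real \<Rightarrow> ennreal"
  assumes f [measurable]: "f \<in> borel_measurable borel" and b: "b > 0"
  shows "(\<integral>\<^sup>+x. f x * indicator {1 / (b + 1)..1 / b} x \<partial>lborel)
       = (\<integral>\<^sup>+t. f (1 / (b + t)) * ennreal (1 / (b + t)\<^sup>2) * indicator {0..1} t \<partial>lborel)"
proof -
  \<comment> \<open>The substitution rule for real integrands, applied to indicators, gives an equality of measures,
    and this extends to all nonnegative integrands. As \<open>t \<mapsto> 1 / (b + t)\<close> is decreasing, the
    rule is used for \<open>t \<mapsto> - 1 / (b + t)\<close> after a reflection.\<close>
  define M1 where "M1 = density lborel (\<lambda>x. indicator {1 / (b + 1)..1 / b} x :: ennreal)"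
  define M2 where
    "M2 = density lborel (\<lambda>t. ennreal (1 / (b + t)\<^sup>2) * indicator {0..1} t)"
  have "M1 = distr M2 borel (\<lambda>t. 1 / (b + t))"
  proof (rule measure_eqI)
    show "sets M1 = sets (distr M2 borel (\<lambda>t. 1 / (b + t)))"
      by (simp add: M1_def)
    fix A assume "A \<in> sets M1"
    then have A [measurable]: "A \<in> sets borel" by (simp add: M1_def)
    have "emeasure M1 A = (\<integral>\<^sup>+x. indicator A x * indicator {1 / (b + 1)..1 / b} x \<partial>lborel)"
      unfolding M1_def by (subst emeasure_density) (auto simp: mult.commute)
    also have "\<dots> = (\<integral>\<^sup>+x. indicator A (- x) * indicator {1 / (b + 1)..1 / b} (- x) \<partial>lborel)"
      by (subst nn_integral_real_affine[where c = "-1" and t = 0]) simp_all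
    also have "\<dots> = (\<integral>\<^sup>+x. ennreal (indicator A (- x)) * indicator {- 1 / (b + 0)..- 1 / (b + 1)} x \<partial>lborel)"
      by (intro nn_integral_cong) (auto split: split_indicator)
    also have "\<dots> = (\<integral>\<^sup>+t. ennreal (indicator A (- (- 1 / (b + t))) * (1 / (b + t)\<^sup>2)) * indicator {0..1} t \<partial>lborel)"
      unfolding nn_integral_set_ennreal
    proof (rule nn_integral_substitution[where g = "\<lambda>t. - 1 / (b + t)" and g' = "\<lambda>t. 1 / (b + t)\<^sup>2"
          and f = "\<lambda>x. indicator A (- x)"])
      show "set_borel_measurable borel {- 1 / (b + 0)..- 1 / (b + 1)} (\<lambda>x. indicat_real A (- x))"
        unfolding set_borel_measurable_def by measurable
      show "((\<lambda>t. - 1 / (b + t)) has_real_derivative 1 / (b + t)\<^sup>2) (at t)" if "t \<in> {0..1}" for t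
        using b that by (auto intro!: derivative_eq_intros simp: power2_eq_square)
      show "continuous_on {0..1} (\<lambda>t. 1 / (b + t)\<^sup>2)"
        using b by (auto intro!: continuous_intros)
    qed auto
    also have "\<dots> = (\<integral>\<^sup>+t. indicator ((\<lambda>t. 1 / (b + t)) -` A) t * (ennreal (1 / (b + t)\<^sup>2) * indicator {0..1} t) \<partial>lborel)"
      by (intro nn_integral_cong) (auto split: split_indicator)
    also have "\<dots> = emeasure M2 ((\<lambda>t. 1 / (b + t)) -` A)"
    proof -
      have "(\<lambda>t. 1 / (b + t)) -` A \<in> sets borel"
        by (rule measurable_sets_borel[OF _ A]) measurable
      then show ?thesis
        unfolding M2_def by (subst emeasure_density) (auto simp: mult.commute)
    qed
    also have "\<dots> = emeasure (distr M2 borel (\<lambda>t. 1 / (b + t))) A"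
      by (subst emeasure_distr) (auto simp: M2_def)
    finally show "emeasure M1 A = emeasure (distr M2 borel (\<lambda>t. 1 / (b + t))) A" .
  qed
  then have "(\<integral>\<^sup>+x. f x \<partial>M1) = (\<integral>\<^sup>+t. f (1 / (b + t)) \<partial>M2)"
    by (simp add: nn_integral_distr M2_def)
  then show ?thesis
    by (simp add: M1_def M2_def nn_integral_density mult_ac)
qed

lemma nn_integral_gauss_branches:
  fixes f :: "real \<Rightarrow> ennreal"
  assumes f [measurable]: "f \<in> borel_measurable borel"
  shows "(\<integral>\<^sup>+x\<in>{0..<1}. f x \<partial>lborel)
       = (\<Sum>n. \<integral>\<^sup>+t\<in>{0..<1}. f (1 / (real (Suc n) + t)) * ennreal (1 / (real (Suc n) + t)\<^sup>2) \<partial>lborel)"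
proof -
  define A where "A n = {1 / (real (Suc n) + 1)<..1 / real (Suc n)}" for n
  have A_iff: "x \<in> A n \<longleftrightarrow> 0 < x \<and> \<lfloor>1 / x\<rfloor> = int (Suc n)" for x n
  proof (cases "0 < x")
    case True
    then show ?thesis
      unfolding A_def by (auto simp: floor_eq_iff divide_less_eq less_divide_eq le_divide_eq divide_le_eq mult.commute)
  next
    case False
    moreover have "0 < 1 / (real (Suc n) + 1)" by simp
    ultimately show ?thesis unfolding A_def by (smt (verit) greaterThanAtMost_iff)
  qed
  have disj: "disjoint_family A"
    by (auto simp: disjoint_family_on_def A_iff)
  have un: "(\<Union>n. A n) = {0<..1}"
  proof (intro subset_antisym subsetI)
    fix x assume "x \<in> (\<Union>n. A n)"
    then obtain n where "x \<in> A n" by blast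
    then have n: "0 < x" "x \<le> 1 / real (Suc n)" using A_iff[of x n] unfolding A_def by auto
    have "1 / real (Suc n) \<le> 1" by simp
    with n show "x \<in> {0<..1}"
      unfolding greaterThanAtMost_iff by linarith
  next
    fix x :: real assume x: "x \<in> {0<..1}"
    then have "\<lfloor>1 / x\<rfloor> \<ge> 1" by (simp add: le_floor_iff)
    then have "x \<in> A (nat (\<lfloor>1 / x\<rfloor> - 1))" using x by (simp add: A_iff)
    then show "x \<in> (\<Union>n. A n)" by blast
  qed
  have [measurable]: "A n \<in> sets borel" for n by (simp add: A_def)
  have "(\<integral>\<^sup>+x\<in>{0..<1}. f x \<partial>lborel) = (\<integral>\<^sup>+x. f x * indicator (\<Union>n. A n) x \<partial>lborel)"
    unfolding un by (intro nn_integral_cong_AE AE_I'[where N = "{0, 1}"])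
       (auto split: split_indicator intro: countable_imp_null_set_lborel)
  also have "\<dots> = (\<integral>\<^sup>+x. (\<Sum>n. f x * indicator (A n) x) \<partial>lborel)"
    by (simp add: suminf_indicator[OF disj])
  also have "\<dots> = (\<Sum>n. \<integral>\<^sup>+x. f x * indicator (A n) x \<partial>lborel)"
    by (intro nn_integral_suminf) auto
  also have "\<dots> = (\<Sum>n. \<integral>\<^sup>+x. f x * indicator {1 / (real (Suc n) + 1)..1 / real (Suc n)} x \<partial>lborel)"
    by (intro suminf_cong nn_integral_cong_AE AE_I[where N = "{1 / (real (Suc _) + 1)}"])
       (auto simp: A_def split: split_indicator)
  also have "\<dots> = (\<Sum>n. \<integral>\<^sup>+t. f (1 / (real (Suc n) + t)) * ennreal (1 / (real (Suc n) + t)\<^sup>2) * indicator {0..1} t \<partial>lborel)"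
    by (subst nn_integral_inverse_shift) auto
  also have "\<dots> = (\<Sum>n. \<integral>\<^sup>+t\<in>{0..<1}. f (1 / (real (Suc n) + t)) * ennreal (1 / (real (Suc n) + t)\<^sup>2) \<partial>lborel)"
    by (intro suminf_cong nn_integral_cong_AE AE_I[where N = "{1}"]) (auto split: split_indicator)
  finally show ?thesis .
qed

text \<open>
  The kernel $f_u$, not normalised: its integral over $[0,1)$ is $1/(1+u)$.
\<close>

definition moebius_density :: "real \<Rightarrow> real \<Rightarrow> real" where
  "moebius_density u t = 1 / (1 + u * t)\<^sup>2"

lemma measurable_moebius_density [measurable (raw)]:
  "f \<in> borel_measurable M \<Longrightarrow> g \<in> borel_measurable M \<Longrightarrow>
    (\<lambda>x. moebius_density (f x) (g x)) \<in> borel_measurable M"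
  unfolding moebius_density_def by measurable

lemma moebius_density_nonneg: "0 \<le> moebius_density u t"
  by (simp add: moebius_density_def)

text \<open>
  The integral of \<open>f\<close> over $[0,1)$ against the kernel $f_u$.
\<close>

definition moebius_integral :: "real \<Rightarrow> (real \<Rightarrow> ennreal) \<Rightarrow> ennreal" where
  "moebius_integral u f = (\<integral>\<^sup>+t\<in>{0..<1}. f t * ennreal (moebius_density u t) \<partial>lborel)"

lemma moebius_density_inverse_shift:
  assumes "0 < b" "0 \<le> u" "0 \<le> t"
  shows "moebius_density u (1 / (b + t)) * (1 / (b + t)\<^sup>2)
       = 1 / (b + u)\<^sup>2 * moebius_density (1 / (b + u)) t"
proof -
  have "(1 + u * (1 / (b + t))) * (b + t) = (b + u) * (1 + 1 / (b + u) * t)"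
    using assms by (simp add: field_simps)
  then show ?thesis
    unfolding moebius_density_def by (simp flip: power_mult_distrib)
qed

lemma moebius_integral_branches:
  assumes [measurable]: "f \<in> borel_measurable borel" and u: "0 \<le> u"
  shows "moebius_integral u f =
    (\<Sum>n. ennreal (1 / (real (Suc n) + u)\<^sup>2) *
        moebius_integral (1 / (real (Suc n) + u)) (\<lambda>t. f (1 / (real (Suc n) + t))))"
proof -
  have "moebius_integral u f = (\<Sum>n. \<integral>\<^sup>+t\<in>{0..<1}. f (1 / (real (Suc n) + t)) *
      ennreal (moebius_density u (1 / (real (Suc n) + t))) * ennreal (1 / (real (Suc n) + t)\<^sup>2) \<partial>lborel)"
    unfolding moebius_integral_def by (subst nn_integral_gauss_branches) auto
  also have "\<dots> = (\<Sum>n. \<integral>\<^sup>+t. ennreal (1 / (real (Suc n) + u)\<^sup>2) * (f (1 / (real (Suc n) + t)) *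
      ennreal (moebius_density (1 / (real (Suc n) + u)) t) * indicator {0..<1} t) \<partial>lborel)"
  proof (intro suminf_cong nn_integral_cong)
    fix n :: nat and t :: real
    show "f (1 / (real (Suc n) + t)) * ennreal (moebius_density u (1 / (real (Suc n) + t))) *
          ennreal (1 / (real (Suc n) + t)\<^sup>2) * indicator {0..<1} t =
        ennreal (1 / (real (Suc n) + u)\<^sup>2) * (f (1 / (real (Suc n) + t)) *
          ennreal (moebius_density (1 / (real (Suc n) + u)) t) * indicator {0..<1} t)"
    proof (cases "0 \<le> t")
      case True
      have "ennreal (moebius_density u (1 / (real (Suc n) + t))) * ennreal (1 / (real (Suc n) + t)\<^sup>2)
          = ennreal (1 / (real (Suc n) + u)\<^sup>2) * ennreal (moebius_density (1 / (real (Suc n) + u)) t)"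
        using moebius_density_inverse_shift[of "real (Suc n)" u t] True u
        by (simp add: moebius_density_nonneg flip: ennreal_mult)
      note * = this
      have "f (1 / (real (Suc n) + t)) * ennreal (moebius_density u (1 / (real (Suc n) + t))) *
          ennreal (1 / (real (Suc n) + t)\<^sup>2) * indicator {0..<1} t =
          f (1 / (real (Suc n) + t)) * (ennreal (moebius_density u (1 / (real (Suc n) + t))) *
          ennreal (1 / (real (Suc n) + t)\<^sup>2)) * indicator {0..<1} t"
        by (simp only: mult.assoc)
      then show ?thesis unfolding * by (simp only: mult_ac)
    qed (simp add: indicator_def)
  qed
  also have "\<dots> = (\<Sum>n. ennreal (1 / (real (Suc n) + u)\<^sup>2) *
        moebius_integral (1 / (real (Suc n) + u)) (\<lambda>t. f (1 / (real (Suc n) + t))))"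
    unfolding moebius_integral_def by (subst nn_integral_cmult) auto
  finally show ?thesis .
qed

lemma gauss_map_branch:
  assumes "0 \<le> t" "t < 1"
  shows "gauss_map (1 / (real (Suc n) + t)) = t" "\<lfloor>1 / (1 / (real (Suc n) + t))\<rfloor> = int (Suc n)"
proof -
  show *: "\<lfloor>1 / (1 / (real (Suc n) + t))\<rfloor> = int (Suc n)"
    using assms by (simp add: floor_eq_iff)
  have "real (Suc n) + t \<noteq> 0" using assms by auto
  then show "gauss_map (1 / (real (Suc n) + t)) = t"
    unfolding gauss_map_def * by simp
qed

lemma moebius_integral_cong:
  "(\<And>t. 0 \<le> t \<Longrightarrow> t < 1 \<Longrightarrow> f t = g t) \<Longrightarrow> moebius_integral u f = moebius_integral u g"
  unfolding moebius_integral_def by (intro nn_integral_cong) (auto split: split_indicator)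

lemma nn_integral_gauss_measure:
  assumes f [measurable]: "f \<in> borel_measurable borel"
  shows "(\<integral>\<^sup>+x. f x \<partial>gauss_measure)
       = (\<integral>\<^sup>+x\<in>{0..<1}. f x * ennreal (1 / ((x + 1) * ln 2)) \<partial>lborel)"
proof -
  have "(\<integral>\<^sup>+x. f x \<partial>gauss_measure)
      = (\<integral>\<^sup>+x. ennreal (1 / ((x + 1) * ln 2)) * f x \<partial>restrict_space lborel {0..<1})"
    unfolding gauss_measure_def
    by (intro nn_integral_density) (auto intro!: measurable_restrict_space1)
  also have "\<dots> = (\<integral>\<^sup>+x\<in>{0..<1}. f x * ennreal (1 / ((x + 1) * ln 2)) \<partial>lborel)"
    by (subst nn_integral_restrict_space) (auto simp: mult.commute)
  finally show ?thesis .
qed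

lemma nn_integral_moebius_density_param:
  assumes "0 \<le> x"
  shows "(\<integral>\<^sup>+u\<in>{0..<1}. ennreal (moebius_density u x) \<partial>lborel) = ennreal (1 / (x + 1))"
proof -
  have "(\<integral>\<^sup>+u\<in>{0..<1}. ennreal (moebius_density u x) \<partial>lborel)
      = (\<integral>\<^sup>+u. ennreal (moebius_density u x) * indicator {0..1} u \<partial>lborel)"
    by (intro nn_integral_cong_AE AE_I[where N = "{1}"]) (auto split: split_indicator)
  also have "\<dots> = ennreal (1 / (1 + 1 * x) - 0 / (1 + 0 * x))"
  proof (rule nn_integral_FTC_Icc)
    fix u :: real assume u: "u \<in> {0..1}"
    then have "0 \<le> u * x" using assms by simp
    then have "1 + u * x \<noteq> 0" by linarith
    then show "((\<lambda>u. u / (1 + u * x)) has_real_derivative moebius_density u x) (at u)"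
      unfolding moebius_density_def
      by (auto intro!: derivative_eq_intros simp: field_simps power2_eq_square)
  qed (auto simp: moebius_density_nonneg)
  finally show ?thesis by (simp add: add.commute)
qed

section \<open>The Gauss measure as a mixture of the kernels\<close>

lemma gauss_measure_mixture:
  assumes f [measurable]: "f \<in> borel_measurable borel"
  shows "(\<integral>\<^sup>+x. f x \<partial>gauss_measure)
       = ennreal (1 / ln 2) * (\<integral>\<^sup>+u\<in>{0..<1}. moebius_integral u f \<partial>lborel)"
proof -
  have "(\<integral>\<^sup>+u\<in>{0..<1}. moebius_integral u f \<partial>lborel)
      = (\<integral>\<^sup>+u. (\<integral>\<^sup>+x. f x * ennreal (moebius_density u x) * indicator {0..<1} x * indicator {0..<1} u \<partial>lborel) \<partial>lborel)"
    unfolding moebius_integral_def by (subst nn_integral_multc) auto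
  also have "\<dots> = (\<integral>\<^sup>+x. (\<integral>\<^sup>+u. f x * ennreal (moebius_density u x) * indicator {0..<1} x * indicator {0..<1} u \<partial>lborel) \<partial>lborel)"
    by (rule lborel_pair.Fubini') measurable
  also have "\<dots> = (\<integral>\<^sup>+x. f x * indicator {0..<1} x * (\<integral>\<^sup>+u\<in>{0..<1}. ennreal (moebius_density u x) \<partial>lborel) \<partial>lborel)"
    by (subst nn_integral_cmult[symmetric]) (auto simp: mult_ac)
  also have "\<dots> = (\<integral>\<^sup>+x. f x * indicator {0..<1} x * ennreal (1 / (x + 1)) \<partial>lborel)"
    by (intro nn_integral_cong) (auto simp: nn_integral_moebius_density_param split: split_indicator)
  finally have "ennreal (1 / ln 2) * (\<integral>\<^sup>+u\<in>{0..<1}. moebius_integral u f \<partial>lborel)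
      = (\<integral>\<^sup>+x. ennreal (1 / ln 2) * (f x * indicator {0..<1} x * ennreal (1 / (x + 1))) \<partial>lborel)"
    by (simp add: nn_integral_cmult)
  also have "\<dots> = (\<integral>\<^sup>+x\<in>{0..<1}. f x * ennreal (1 / ((x + 1) * ln 2)) \<partial>lborel)"
  proof (intro nn_integral_cong)
    fix x :: real
    show "ennreal (1 / ln 2) * (f x * indicator {0..<1} x * ennreal (1 / (x + 1)))
        = f x * ennreal (1 / ((x + 1) * ln 2)) * indicator {0..<1} x"
    proof (cases "0 \<le> x")
      case True
      then have "ennreal (1 / ((x + 1) * ln 2)) = ennreal (1 / ln 2) * ennreal (1 / (x + 1))"
        by (simp add: mult.commute flip: ennreal_mult)
      then show ?thesis by (simp add: mult_ac)
    qed simp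
  qed
  also have "\<dots> = (\<integral>\<^sup>+x. f x \<partial>gauss_measure)"
    by (rule nn_integral_gauss_measure[symmetric]) fact
  finally show ?thesis by simp
qed

text \<open>
  Invariance needs no series: by \<open>moebius_integral_branches\<close> the mixture of the integrals of
  $f \circ G$ is a sum over $b$ of integrals over $u$, and in the variable $v = 1/(b+u)$ this sum
  is again the branch formula, now for the function that sends \<open>v\<close> to \<open>moebius_integral v f\<close>.
\<close>

lemma gauss_measure_invariant:
  assumes f [measurable]: "f \<in> borel_measurable borel"
  shows "(\<integral>\<^sup>+x. f (gauss_map x) \<partial>gauss_measure) = (\<integral>\<^sup>+x. f x \<partial>gauss_measure)"
proof -
  let ?K = "\<lambda>v. moebius_integral v f"
  have K [measurable]: "?K \<in> borel_measurable borel"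
    unfolding moebius_integral_def by measurable
  have "(\<integral>\<^sup>+u\<in>{0..<1}. moebius_integral u (\<lambda>x. f (gauss_map x)) \<partial>lborel)
      = (\<integral>\<^sup>+u\<in>{0..<1}. (\<Sum>n. ennreal (1 / (real (Suc n) + u)\<^sup>2) * ?K (1 / (real (Suc n) + u))) \<partial>lborel)"
  proof (intro nn_integral_cong)
    fix u :: real
    have "moebius_integral u (\<lambda>x. f (gauss_map x))
        = (\<Sum>n. ennreal (1 / (real (Suc n) + u)\<^sup>2) * ?K (1 / (real (Suc n) + u)))" if "0 \<le> u"
      using that gauss_map_branch(1)
      by (subst moebius_integral_branches) (auto intro!: suminf_cong arg_cong2[where f = "(*)"] moebius_integral_cong)
    then show "moebius_integral u (\<lambda>x. f (gauss_map x)) * indicator {0..<1} u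
        = (\<Sum>n. ennreal (1 / (real (Suc n) + u)\<^sup>2) * ?K (1 / (real (Suc n) + u))) * indicator {0..<1} u"
      by (auto split: split_indicator)
  qed
  also have "\<dots> = (\<integral>\<^sup>+u. (\<Sum>n. ennreal (1 / (real (Suc n) + u)\<^sup>2) * ?K (1 / (real (Suc n) + u)) * indicator {0..<1} u) \<partial>lborel)"
    by simp
  also have "\<dots> = (\<Sum>n. \<integral>\<^sup>+u\<in>{0..<1}. ennreal (1 / (real (Suc n) + u)\<^sup>2) * ?K (1 / (real (Suc n) + u)) \<partial>lborel)"
    by (rule nn_integral_suminf) measurable
  also have "\<dots> = (\<integral>\<^sup>+u\<in>{0..<1}. ?K u \<partial>lborel)"
    by (subst nn_integral_gauss_branches) (auto simp: mult.commute)
  finally show ?thesis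
    by (simp add: gauss_measure_mixture)
qed

section \<open>The constant\<close>

lemma ln_2_bounds_fine: "69314 / 100000 \<le> ln (2 :: real)" "ln (2 :: real) \<le> 69315 / 100000"
  using ln_approx_bounds[of 2 5] by (simp_all add: eval_nat_numeral)

text \<open>
  The value $\delta$ of the first mixing coefficient.
\<close>

definition phi_const :: real where
  "phi_const = - ((1 - ln 2 + ln (ln 2)) / ln 2)"

lemma le_phi_constI:
  assumes "c * ln 2 \<le> ln 2 - 1 - ln (ln 2)"
  shows "c \<le> phi_const"
proof -
  have "c \<le> (ln 2 - 1 - ln (ln 2)) / ln 2"
    using assms by (subst pos_le_divide_eq) auto
  also have "\<dots> = phi_const"
    unfolding phi_const_def minus_divide_left by simp
  finally show ?thesis .
qed

lemma phi_const_less: "phi_const < 861 / 10000"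
proof -
  have "ln (144271 / 100000 :: real) \<le> 36653 / 100000"
    using ln_approx_bounds[of "144271 / 100000" 4] by (simp add: eval_nat_numeral)
  moreover have "- ln (ln 2) \<le> ln (144271 / 100000 :: real)"
  proof -
    have "- ln (ln 2) = ln (inverse (ln 2 :: real))" by (simp add: ln_inverse)
    also have "\<dots> \<le> ln (144271 / 100000)"
    proof -
      have "inverse (ln 2 :: real) \<le> inverse (100000 / 144271)"
        using ln_2_bounds_fine(1) by (intro le_imp_inverse_le) auto
      then show ?thesis by simp
    qed
    finally show ?thesis .
  qed
  ultimately have "- (1 - ln 2 + ln (ln 2)) < 861 / 10000 * ln (2 :: real)"
    using ln_2_bounds_fine by linarith
  then show ?thesis
    unfolding phi_const_def by (simp add: field_simps)
qed

lemma phi_const_ge: "1 / 20 \<le> phi_const"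
proof -
  have "36 / 100 \<le> ln (14426 / 10000 :: real)"
    using ln_approx_bounds[of "14426 / 10000" 2] by (simp add: eval_nat_numeral)
  also have "\<dots> \<le> ln (inverse (ln 2 :: real))"
  proof -
    have "inverse (69315 / 100000) \<le> inverse (ln 2 :: real)"
      using ln_2_bounds_fine by (intro le_imp_inverse_le) auto
    then show ?thesis by simp
  qed
  also have "\<dots> = - ln (ln 2)" by (simp add: ln_inverse)
  finally have "1 / 20 * ln 2 \<le> - (1 - ln 2 + ln (ln (2 :: real)))"
    using ln_2_bounds_fine by linarith
  then show ?thesis
    unfolding phi_const_def by (simp add: field_simps)
qed

section \<open>Total variation distance of the kernels to the Gauss measure\<close>

text \<open>
  The distribution function $H$ of the Gauss measure on $[0,1]$.
\<close>

definition gauss_cdf :: "real \<Rightarrow> real" where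
  "gauss_cdf x = ln (1 + x) / ln 2"

text \<open>
  The distribution function $F_u$ of the probability density $(1+u) f_u$ on $[0,1]$.
\<close>

definition moebius_cdf :: "real \<Rightarrow> real \<Rightarrow> real" where
  "moebius_cdf u x = (1 + u) * x / (1 + u * x)"

lemma gauss_cdf_mult_ln_2: "gauss_cdf x * ln 2 = ln (1 + x)"
  by (simp add: gauss_cdf_def)

lemma DERIV_gauss_cdf:
  assumes "0 \<le> t"
  shows "(gauss_cdf has_real_derivative 1 / ((t + 1) * ln 2)) (at t)"
proof -
  have "((\<lambda>x. ln (1 + x)) has_real_derivative 1 / (t + 1)) (at t)"
    using assms by (auto intro!: derivative_eq_intros simp: add.commute)
  from DERIV_cdivide[OF this, of "ln 2"] show ?thesis
    unfolding gauss_cdf_def[abs_def] by (simp only: divide_divide_eq_left)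
qed

text \<open>
  The extreme cases \<open>u = 0\<close> and \<open>u = 1\<close> give the same maximum $\delta$, because
  $x \mapsto (1-x)/(1+x)$ preserves the Gauss measure and exchanges the uniform law with the law
  of density $2/(1+x)^2$.
\<close>

lemma gauss_cdf_minus_id_le:
  assumes "0 \<le> x"
  shows "gauss_cdf x - x \<le> phi_const"
proof (rule le_phi_constI)
  have "ln ((1 + x) * ln 2) \<le> (1 + x) * ln 2 - 1"
    using assms by (intro ln_le_minus_one) auto
  moreover have "ln ((1 + x) * ln 2) = ln (1 + x) + ln (ln 2)"
    using assms by (subst ln_mult) auto
  ultimately show "(gauss_cdf x - x) * ln 2 \<le> ln 2 - 1 - ln (ln 2)"
    by (simp add: left_diff_distrib gauss_cdf_mult_ln_2 distrib_right)
qed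

lemma moebius_cdf_minus_gauss_cdf_le:
  assumes "0 \<le> x"
  shows "2 * x / (1 + x) - gauss_cdf x \<le> phi_const"
proof (rule le_phi_constI)
  have "ln (2 * ln 2 / (1 + x)) \<le> 2 * ln 2 / (1 + x) - 1"
    using assms by (intro ln_le_minus_one) auto
  moreover have "ln (2 * ln 2 / (1 + x)) = ln 2 + ln (ln 2) - ln (1 + x)"
    using assms by (simp add: ln_div ln_mult)
  moreover have "2 * ln 2 / (1 + x) = 2 * ln 2 - 2 * x / (1 + x) * ln 2"
    using assms by (simp add: field_simps)
  ultimately show "(2 * x / (1 + x) - gauss_cdf x) * ln 2 \<le> ln 2 - 1 - ln (ln 2)"
    unfolding left_diff_distrib gauss_cdf_mult_ln_2 by linarith
qed

text \<open>
  The difference of the probability densities $(1+u) f_u$ and $1/((1+t)\log 2)$. The coercion to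
  extended nonnegative reals is its positive part, whose integral over $[0,1)$ is the total
  variation distance.
\<close>

definition excess_density :: "real \<Rightarrow> real \<Rightarrow> real" where
  "excess_density u t = (1 + u) * moebius_density u t - 1 / ((t + 1) * ln 2)"

lemma excess_density_antiderivative:
  assumes "0 \<le> u" "0 \<le> t"
  shows "((\<lambda>t. moebius_cdf u t - gauss_cdf t) has_real_derivative excess_density u t) (at t)"
proof -
  have "1 + u * t \<noteq> 0" using assms by (smt (verit) mult_nonneg_nonneg)
  then have "(moebius_cdf u has_real_derivative (1 + u) * moebius_density u t) (at t)"
    unfolding moebius_cdf_def[abs_def] moebius_density_def
    by (auto intro!: derivative_eq_intros simp: power2_eq_square) (simp add: field_simps)
  from this DERIV_gauss_cdf[OF assms(2)] show ?thesis
    unfolding excess_density_def by (rule DERIV_diff)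
qed

text \<open>
  A polynomial of degree at most 2 in \<open>t\<close>; its sign is opposite to that of the excess density
  when \<open>u\<close> and \<open>t\<close> are nonnegative.
\<close>

definition excess_numerator :: "real \<Rightarrow> real \<Rightarrow> real" where
  "excess_numerator u t = (1 + u * t)\<^sup>2 - (1 + u) * ln 2 * (1 + t)"

lemma excess_density_sign:
  assumes "0 \<le> u" "0 \<le> t"
  shows "excess_density u t \<le> 0 \<longleftrightarrow> 0 \<le> excess_numerator u t"
    and "0 \<le> excess_density u t \<longleftrightarrow> excess_numerator u t \<le> 0"
proof -
  have pos: "0 < (1 + u * t)\<^sup>2" "0 < (t + 1) * ln 2"
    using assms by (auto simp: add_nonneg_eq_0_iff intro!: zero_less_power add_pos_nonneg)
  have frac: "c / a - 1 / b \<le> 0 \<longleftrightarrow> c * b \<le> a" "0 \<le> c / a - 1 / b \<longleftrightarrow> a \<le> c * b"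
    if "0 < a" "0 < b" for a b c :: real
    using that by (simp_all add: field_simps)
  show "excess_density u t \<le> 0 \<longleftrightarrow> 0 \<le> excess_numerator u t"
    "0 \<le> excess_density u t \<longleftrightarrow> excess_numerator u t \<le> 0"
    unfolding excess_density_def moebius_density_def excess_numerator_def
    using frac[OF pos, of "1 + u"] by (simp_all add: mult_ac add_ac)
qed

lemma excess_numerator_one: "excess_numerator u 1 = (1 + u) * (1 + u - 2 * ln 2)"
  by (simp add: excess_numerator_def power2_eq_square algebra_simps)

lemma isCont_excess_numerator: "isCont (excess_numerator u) t"
  unfolding excess_numerator_def[abs_def] by (intro continuous_intros)

text \<open>
  The quotient of the numerator by $1+t$ vanishes at \<open>x\<close>. The last factor below determines
  its monotonicity: it is positive for \<open>u < 1 / 3\<close> and nonpositive for \<open>u \<ge> 1 / 2\<close>, for all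
  \<open>x\<close> and \<open>t\<close> in $[0,1]$.
\<close>

lemma excess_numerator_factor:
  assumes "excess_numerator u x = 0"
  shows "(x - t) * excess_numerator u t * (1 + x)
       = (x - t)\<^sup>2 * (1 - 2 * u - u\<^sup>2 * (x + t + x * t))"
proof -
  have "excess_numerator u t * (1 + x)
      = excess_numerator u t * (1 + x) - excess_numerator u x * (1 + t)"
    using assms by simp
  also have "\<dots> = (x - t) * (1 - 2 * u - u\<^sup>2 * (x + t + x * t))"
    by (simp add: excess_numerator_def power2_eq_square algebra_simps)
  finally show ?thesis
    by (simp only: mult.assoc power2_eq_square)
qed

lemma nn_integral_excess_interval:
  assumes u: "0 \<le> u" and ab: "0 \<le> a" "a \<le> b" "b \<le> 1"
    and sgn: "\<And>t. 0 \<le> t \<Longrightarrow> t \<le> 1 \<Longrightarrow> t \<notin> {a..b} \<Longrightarrow> excess_density u t \<le> 0"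
      "\<And>t. t \<in> {a..b} \<Longrightarrow> 0 \<le> excess_density u t"
  shows "(\<integral>\<^sup>+t\<in>{0..<1}. ennreal (excess_density u t) \<partial>lborel)
       = ennreal ((moebius_cdf u b - gauss_cdf b) - (moebius_cdf u a - gauss_cdf a))"
proof -
  have [measurable]: "excess_density u \<in> borel_measurable borel"
    unfolding excess_density_def by measurable
  have "(\<integral>\<^sup>+t\<in>{0..<1}. ennreal (excess_density u t) \<partial>lborel)
      = (\<integral>\<^sup>+t. ennreal (excess_density u t) * indicator {a..b} t \<partial>lborel)"
    using ab sgn(1)
    by (intro nn_integral_cong_AE AE_I[where N = "{1}"])
       (auto split: split_indicator simp: ennreal_neg)
  also have "\<dots> = ennreal ((moebius_cdf u b - gauss_cdf b) - (moebius_cdf u a - gauss_cdf a))"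
    using u ab sgn(2) by (intro nn_integral_FTC_Icc excess_density_antiderivative) auto
  finally show ?thesis .
qed

lemma excess_small_param:
  assumes u: "0 \<le> u" "u \<le> 1 / 3"
  shows "(\<integral>\<^sup>+t\<in>{0..<1}. ennreal (excess_density u t) \<partial>lborel) \<le> ennreal phi_const"
proof -
  let ?p = "excess_numerator u"
  have "(1 + u) * ln 2 \<le> 4 / 3 * (25 / 36)"
    using u ln2_le_25_over_36 by (intro mult_mono) auto
  then have p0: "0 \<le> ?p 0" by (simp add: excess_numerator_def)
  have "?p 1 = (1 + u) * (1 + u - 2 * ln 2)"
    by (rule excess_numerator_one)
  also have "\<dots> \<le> 0"
    using u ln2_ge_two_thirds by (intro mult_nonneg_nonpos) auto
  finally have p1: "?p 1 \<le> 0" .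
  \<comment> \<open>The point where the excess changes from negative to positive.\<close>
  obtain x where x: "0 \<le> x" "x \<le> 1" "?p x = 0"
    using IVT2[of ?p 1 0 0] p0 p1 by (auto intro!: isCont_excess_numerator)
  have mono: "(x - t) * ?p t \<ge> 0" if "0 \<le> t" "t \<le> 1" for t
  proof -
    note excess_numerator_factor[OF x(3), of t]
    moreover have "u\<^sup>2 * (x + t + x * t) \<le> (1 / 3)\<^sup>2 * 3"
      using that x u mult_mono[of x 1 t 1] by (intro mult_mono power_mono) auto
    moreover have "0 \<le> 1 - 2 * u - (1 / 3)\<^sup>2 * 3"
      using u by (simp add: power2_eq_square)
    ultimately have "0 \<le> (x - t) * ?p t * (1 + x)"
      by (smt (verit) mult_nonneg_nonneg zero_le_power2)
    then show ?thesis using x by (simp add: zero_le_mult_iff)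
  qed
  have "(\<integral>\<^sup>+t\<in>{0..<1}. ennreal (excess_density u t) \<partial>lborel)
      = ennreal ((moebius_cdf u 1 - gauss_cdf 1) - (moebius_cdf u x - gauss_cdf x))"
  proof (rule nn_integral_excess_interval)
    fix t :: real assume "0 \<le> t" "t \<le> 1" "t \<notin> {x..1}"
    with mono[of t] have "0 \<le> ?p t" by (simp add: zero_le_mult_iff)
    then show "excess_density u t \<le> 0"
      using excess_density_sign[of u t] u \<open>0 \<le> t\<close> by simp
  next
    fix t assume t: "t \<in> {x..1}"
    with mono[of t] x have "?p t \<le> 0" by (cases "t = x") (auto simp: zero_le_mult_iff)
    then show "0 \<le> excess_density u t"
      using excess_density_sign[of u t] u x t by simp
  qed (use u x in auto)
  also have "\<dots> \<le> ennreal phi_const"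
  proof (rule ennreal_leI)
    have "x * (1 + u * x) \<le> x * (1 + u)"
      using u x mult_left_mono[of x 1 u] by (intro mult_left_mono) auto
    moreover have "0 < 1 + u * x" using u x by (simp add: add_pos_nonneg)
    ultimately have "x \<le> moebius_cdf u x"
      unfolding moebius_cdf_def by (simp add: pos_le_divide_eq mult.commute)
    moreover have "moebius_cdf u 1 = 1" "gauss_cdf 1 = 1"
      using u by (simp_all add: moebius_cdf_def gauss_cdf_def)
    ultimately show "(moebius_cdf u 1 - gauss_cdf 1) - (moebius_cdf u x - gauss_cdf x) \<le> phi_const"
      using gauss_cdf_minus_id_le[OF x(1)] by simp
  qed
  finally show ?thesis .
qed

lemma excess_large_param:
  assumes u: "1 / 2 \<le> u" "u \<le> 1"
  shows "(\<integral>\<^sup>+t\<in>{0..<1}. ennreal (excess_density u t) \<partial>lborel) \<le> ennreal phi_const"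
proof -
  let ?p = "excess_numerator u"
  have "3 / 2 * (2 / 3) \<le> (1 + u) * ln 2"
    using u ln2_ge_two_thirds by (intro mult_mono) auto
  then have p0: "?p 0 \<le> 0" by (simp add: excess_numerator_def)
  have "?p 1 = (1 + u) * (1 + u - 2 * ln 2)"
    by (rule excess_numerator_one)
  also have "\<dots> \<ge> 0"
    using u ln2_le_25_over_36 by (intro mult_nonneg_nonneg) auto
  finally have p1: "0 \<le> ?p 1" .
  \<comment> \<open>The point where the excess changes from positive to negative.\<close>
  obtain x where x: "0 \<le> x" "x \<le> 1" "?p x = 0"
    using IVT[of ?p 0 0 1] p0 p1 by (auto intro!: isCont_excess_numerator)
  have mono: "(x - t) * ?p t \<le> 0" if "0 \<le> t" "t \<le> 1" for t
  proof -
    note excess_numerator_factor[OF x(3), of t]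
    moreover have "0 \<le> u\<^sup>2 * (x + t + x * t)"
      using that x by simp
    ultimately have "(x - t) * ?p t * (1 + x) \<le> 0"
      using u by (simp add: mult_nonneg_nonpos)
    then show ?thesis using x by (simp add: mult_le_0_iff)
  qed
  have "(\<integral>\<^sup>+t\<in>{0..<1}. ennreal (excess_density u t) \<partial>lborel)
      = ennreal ((moebius_cdf u x - gauss_cdf x) - (moebius_cdf u 0 - gauss_cdf 0))"
  proof (rule nn_integral_excess_interval)
    fix t :: real assume "0 \<le> t" "t \<le> 1" "t \<notin> {0..x}"
    with mono[of t] have "0 \<le> ?p t" by (simp add: mult_le_0_iff)
    then show "excess_density u t \<le> 0"
      using excess_density_sign[of u t] u \<open>0 \<le> t\<close> by simp
  next
    fix t assume t: "t \<in> {0..x}"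
    with mono[of t] x have "?p t \<le> 0" by (cases "t = x") (auto simp: mult_le_0_iff)
    then show "0 \<le> excess_density u t"
      using excess_density_sign[of u t] u x t by simp
  qed (use u x in auto)
  also have "\<dots> \<le> ennreal phi_const"
  proof (rule ennreal_leI)
    have "(1 + u) * x * (1 + x) \<le> 2 * x * (1 + u * x)"
    proof -
      have "0 \<le> x * ((1 - u) * (1 - x))" using u x by simp
      then show ?thesis by (simp add: algebra_simps)
    qed
    moreover have "0 < 1 + u * x" using u x by (simp add: add_pos_nonneg)
    ultimately have "moebius_cdf u x \<le> 2 * x / (1 + x)"
      unfolding moebius_cdf_def using x by (simp add: divide_simps)
    then show "(moebius_cdf u x - gauss_cdf x) - (moebius_cdf u 0 - gauss_cdf 0) \<le> phi_const"
      using moebius_cdf_minus_gauss_cdf_le[OF x(1)] by (simp add: moebius_cdf_def gauss_cdf_def)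
  qed
  finally show ?thesis .
qed

lemma excess_middle_param:
  assumes u: "1 / 3 \<le> u" "u \<le> 1 / 2"
  shows "(\<integral>\<^sup>+t\<in>{0..<1}. ennreal (excess_density u t) \<partial>lborel) \<le> ennreal phi_const"
proof -
  have bound: "excess_density u t \<le> phi_const * (1 / ((t + 1) * ln 2))" if t: "0 \<le> t" for t
  proof -
    \<comment> \<open>Arithmetic-geometric mean for the decomposition \<open>1 + u * t = u * (1 + t) + (1 - u)\<close>.\<close>
    have "0 \<le> (u * (1 + t) - (1 - u))\<^sup>2" by simp
    then have amgm: "4 * u * (1 - u) * (1 + t) \<le> (1 + u * t)\<^sup>2"
      by (simp add: power2_eq_square algebra_simps)
    \<comment> \<open>The two roots are the ends of the range of \<open>u\<close>.\<close>
    have "(2 * u - 1) * (3 * u - 1) \<le> 0"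
      using u by (intro mult_nonpos_nonneg) auto
    then have "1 + u \<le> 3 / 2 * (4 * u * (1 - u))"
      by (simp add: algebra_simps)
    then have "(1 + u) * (1 + t) \<le> 3 / 2 * (4 * u * (1 - u)) * (1 + t)"
      using t by (intro mult_right_mono) auto
    with amgm have "(1 + u) * (1 + t) \<le> 3 / 2 * (1 + u * t)\<^sup>2" by simp
    moreover have pos: "0 < 1 + u * t" using u t by (simp add: add_pos_nonneg)
    ultimately have "(1 + u) * moebius_density u t \<le> 3 / 2 / (t + 1)"
      unfolding moebius_density_def using t
      by (simp add: divide_simps algebra_simps)
    also have "\<dots> = 3 / 2 * ln 2 * (1 / ((t + 1) * ln 2))" using t by simp
    also have "\<dots> \<le> (1 + phi_const) * (1 / ((t + 1) * ln 2))"
      using phi_const_ge ln2_le_25_over_36 t by (intro mult_right_mono) auto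
    also have "\<dots> = 1 / ((t + 1) * ln 2) + phi_const * (1 / ((t + 1) * ln 2))"
      by (simp only: distrib_right mult_1_left)
    finally show ?thesis
      unfolding excess_density_def by linarith
  qed
  have "(\<integral>\<^sup>+t\<in>{0..<1}. ennreal (excess_density u t) \<partial>lborel)
      \<le> (\<integral>\<^sup>+t\<in>{0..<1}. ennreal phi_const * ennreal (1 / ((t + 1) * ln 2)) \<partial>lborel)"
    using bound phi_const_ge
    by (intro nn_integral_mono) (auto split: split_indicator intro!: ennreal_leI simp flip: ennreal_mult)
  also have "\<dots> = (\<integral>\<^sup>+t. ennreal phi_const \<partial>gauss_measure)"
    by (subst nn_integral_gauss_measure) auto
  also have "\<dots> = ennreal phi_const"
    using prob_space.emeasure_space_1[OF prob_space_gauss_measure] by simp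
  finally show ?thesis .
qed

lemma excess_le:
  assumes "0 \<le> u" "u \<le> 1"
  shows "(\<integral>\<^sup>+t\<in>{0..<1}. ennreal (excess_density u t) \<partial>lborel) \<le> ennreal phi_const"
  using assms excess_small_param excess_middle_param excess_large_param
  by (cases "u \<le> 1 / 3"; cases "u \<le> 1 / 2") auto

lemma moebius_integral_le:
  assumes u: "0 \<le> u" "u \<le> 1" and E [measurable]: "E \<in> sets borel"
  shows "moebius_integral u (indicator E)
    \<le> ((\<integral>\<^sup>+x. indicator E x \<partial>gauss_measure) + ennreal phi_const) * moebius_integral u (\<lambda>_. 1)"
proof -
  have [measurable]: "excess_density u \<in> borel_measurable borel"
    unfolding excess_density_def by measurable
  have dens: "ennreal ((1 + u) * moebius_density u t)
      \<le> ennreal (1 / ((t + 1) * ln 2)) + ennreal (excess_density u t)" if "0 \<le> t" for t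
  proof -
    have "ennreal ((1 + u) * moebius_density u t) = ennreal (1 / ((t + 1) * ln 2) + excess_density u t)"
      by (simp add: excess_density_def)
    also have "\<dots> \<le> ennreal (1 / ((t + 1) * ln 2)) + ennreal (excess_density u t)"
      using that by (cases "0 \<le> excess_density u t") (auto simp: ennreal_plus ennreal_neg intro!: ennreal_leI)
    finally show ?thesis .
  qed
  have "ennreal (1 + u) * moebius_integral u (indicator E)
      = (\<integral>\<^sup>+t. ennreal (1 + u) * (indicator E t * ennreal (moebius_density u t) * indicator {0..<1} t) \<partial>lborel)"
    unfolding moebius_integral_def by (subst nn_integral_cmult) auto
  also have "\<dots> = (\<integral>\<^sup>+t. ennreal ((1 + u) * moebius_density u t) * indicator E t * indicator {0..<1} t \<partial>lborel)"
    using u by (intro nn_integral_cong) (auto simp: ennreal_mult moebius_density_nonneg split: split_indicator)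
  also have "\<dots> \<le> (\<integral>\<^sup>+t. indicator E t * ennreal (1 / ((t + 1) * ln 2)) * indicator {0..<1} t +
      ennreal (excess_density u t) * indicator {0..<1} t \<partial>lborel)"
    using dens by (intro nn_integral_mono) (auto split: split_indicator)
  also have "\<dots> = (\<integral>\<^sup>+x. indicator E x \<partial>gauss_measure) + (\<integral>\<^sup>+t\<in>{0..<1}. ennreal (excess_density u t) \<partial>lborel)"
    by (subst nn_integral_add) (auto simp: nn_integral_gauss_measure)
  also have "\<dots> \<le> (\<integral>\<^sup>+x. indicator E x \<partial>gauss_measure) + ennreal phi_const"
    using excess_le[OF u] by (rule add_left_mono)
  finally have main: "ennreal (1 + u) * moebius_integral u (indicator E)
      \<le> (\<integral>\<^sup>+x. indicator E x \<partial>gauss_measure) + ennreal phi_const" .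
  have "moebius_integral u (\<lambda>_. 1) = ennreal (1 / (u + 1))"
    using nn_integral_moebius_density_param[of u] u
    by (simp add: moebius_integral_def moebius_density_def mult.commute)
  then have one: "moebius_integral u (\<lambda>_. 1) * ennreal (1 + u) = 1"
    using u by (simp add: add.commute flip: ennreal_mult ennreal_plus ennreal_1)
  have "moebius_integral u (indicator E)
      = (moebius_integral u (\<lambda>_. 1) * ennreal (1 + u)) * moebius_integral u (indicator E)"
    unfolding one by simp
  also have "\<dots> = (ennreal (1 + u) * moebius_integral u (indicator E)) * moebius_integral u (\<lambda>_. 1)"
    by (simp only: mult_ac)
  also have "\<dots> \<le> ((\<integral>\<^sup>+x. indicator E x \<partial>gauss_measure) + ennreal phi_const) * moebius_integral u (\<lambda>_. 1)"
    using main by (rule mult_right_mono) simp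
  finally show ?thesis .
qed

section \<open>The law of the orbit given the first digits\<close>

text \<open>
  The list of the first \<open>k\<close> continued fraction digits.
\<close>

primrec cf_digits :: "nat \<Rightarrow> real \<Rightarrow> int list" where
  "cf_digits 0 x = []"
| "cf_digits (Suc k) x = \<lfloor>1 / x\<rfloor> # cf_digits k (gauss_map x)"

lemma cf_digits_nth: "j < k \<Longrightarrow> cf_digits k x ! j = cf_digit (Suc j) x"
proof (induction k arbitrary: j x)
  case (Suc k)
  then show ?case
    by (cases j) (auto simp: cf_digit_def funpow_swap1)
qed simp

lemma measurable_cf_digits [measurable]: "cf_digits k \<in> measurable borel (count_space UNIV)"
proof (induction k)
  case (Suc k)
  note [measurable] = Suc.IH
  have "{x. cf_digits (Suc k) x = l} \<in> sets borel" for l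
  proof (cases l)
    case (Cons a l')
    have "{x \<in> space borel. \<lfloor>1 / x\<rfloor> = a \<and> cf_digits k (gauss_map x) = l'} \<in> sets borel"
      by measurable
    then show ?thesis by (simp add: Cons)
  qed simp
  then show ?case
    by (subst measurable_count_space_eq2_countable) (auto simp: vimage_def)
qed simp

lemma measurable_gauss_map_funpow [measurable]: "(gauss_map ^^ k) \<in> borel_measurable borel"
  by (induction k) (auto intro: measurable_comp[OF _ measurable_gauss_map])

lemma cf_digits_branch:
  assumes "0 \<le> t" "t < 1"
  shows "cf_digits (Suc k) (1 / (real (Suc n) + t)) = int (Suc n) # cf_digits k t"
  by (simp only: cf_digits.simps gauss_map_branch[OF assms])

lemma gauss_map_funpow_branch:
  assumes "0 \<le> t" "t < 1"
  shows "(gauss_map ^^ Suc k) (1 / (real (Suc n) + t)) = (gauss_map ^^ k) t"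
  by (simp only: funpow_Suc_right comp_apply gauss_map_branch[OF assms])

text \<open>
  The bound for \<open>k = 0\<close> passes through every branch, since each branch only changes the
  parameter of the kernel; \<open>A\<close> is an arbitrary set of digit lists, so unions of cylinders are
  covered at once.
\<close>

lemma moebius_integral_cylinder_le:
  assumes E [measurable]: "E \<in> sets borel" and "0 \<le> u" "u \<le> 1"
  shows "moebius_integral u (\<lambda>x. indicator A (cf_digits k x) * indicator E ((gauss_map ^^ k) x))
    \<le> ((\<integral>\<^sup>+x. indicator E x \<partial>gauss_measure) + ennreal phi_const) *
        moebius_integral u (\<lambda>x. indicator A (cf_digits k x))"
  using assms(2,3)
proof (induction k arbitrary: u A)
  case 0
  show ?case
  proof (cases "[] \<in> A")
    case True
    then show ?thesis using moebius_integral_le[OF 0 E] by simp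
  qed (simp add: moebius_integral_def)
next
  case (Suc k)
  let ?c = "(\<integral>\<^sup>+x. indicator E x \<partial>gauss_measure) + ennreal phi_const"
  define B where "B n = {l. int (Suc n) # l \<in> A}" for n
  define v where "v n = 1 / (real (Suc n) + u)" for n
  have v: "0 \<le> v n" "v n \<le> 1" for n using Suc.prems by (auto simp: v_def)
  have [measurable]: "(gauss_map ^^ Suc k) \<in> borel_measurable borel" "cf_digits (Suc k) \<in> measurable borel (count_space UNIV)"
    by (fact measurable_gauss_map_funpow, fact measurable_cf_digits)
  have "moebius_integral u (\<lambda>x. indicator A (cf_digits (Suc k) x) * indicator E ((gauss_map ^^ Suc k) x))
      = (\<Sum>n. ennreal (1 / (real (Suc n) + u)\<^sup>2) * moebius_integral (v n)
          (\<lambda>t. indicator (B n) (cf_digits k t) * indicator E ((gauss_map ^^ k) t)))"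
    unfolding v_def
    by (subst moebius_integral_branches[OF _ Suc.prems(1)], measurable)
       (intro suminf_cong arg_cong2[where f = "(*)"] refl moebius_integral_cong,
        simp_all only: cf_digits_branch gauss_map_funpow_branch B_def indicator_def mem_Collect_eq)
  also have "\<dots> \<le> (\<Sum>n. ennreal (1 / (real (Suc n) + u)\<^sup>2) *
      (?c * moebius_integral (v n) (\<lambda>t. indicator (B n) (cf_digits k t))))"
    using v by (intro suminf_le mult_left_mono Suc.IH) auto
  also have "\<dots> = ?c * (\<Sum>n. ennreal (1 / (real (Suc n) + u)\<^sup>2) *
      moebius_integral (v n) (\<lambda>t. indicator (B n) (cf_digits k t)))"
    by (subst ennreal_suminf_cmult[symmetric]) (simp only: mult_ac)
  also have "(\<Sum>n. ennreal (1 / (real (Suc n) + u)\<^sup>2) *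
        moebius_integral (v n) (\<lambda>t. indicator (B n) (cf_digits k t)))
      = moebius_integral u (\<lambda>x. indicator A (cf_digits (Suc k) x))"
    unfolding v_def
    by (subst moebius_integral_branches[OF _ Suc.prems(1)], measurable)
       (intro suminf_cong arg_cong2[where f = "(*)"] refl moebius_integral_cong,
        simp only: cf_digits_branch B_def indicator_def mem_Collect_eq)
  finally show ?case .
qed

lemma emeasure_gauss_measure:
  assumes "S \<in> sets borel"
  shows "emeasure gauss_measure ({0..<1} \<inter> S) = (\<integral>\<^sup>+x. indicator S x \<partial>gauss_measure)"
proof -
  have "{0..<1} \<inter> S \<in> sets gauss_measure"
    using assms by (auto simp: sets_gauss_measure sets_restrict_space)
  then have "emeasure gauss_measure ({0..<1} \<inter> S) = (\<integral>\<^sup>+x. indicator ({0..<1} \<inter> S) x \<partial>gauss_measure)"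
    by simp
  also have "\<dots> = (\<integral>\<^sup>+x. indicator S x \<partial>gauss_measure)"
    by (intro nn_integral_cong) (auto simp: space_gauss_measure split: split_indicator)
  finally show ?thesis .
qed

lemma emeasure_gauss_cylinder_le:
  assumes E [measurable]: "E \<in> sets borel"
  shows "emeasure gauss_measure ({0..<1} \<inter> {x. cf_digits k x \<in> A \<and> (gauss_map ^^ k) x \<in> E})
    \<le> (emeasure gauss_measure ({0..<1} \<inter> E) + ennreal phi_const) *
        emeasure gauss_measure ({0..<1} \<inter> {x. cf_digits k x \<in> A})"
proof -
  let ?c = "(\<integral>\<^sup>+x. indicator E x \<partial>gauss_measure) + ennreal phi_const"
  have [measurable]: "{x. cf_digits k x \<in> A} \<in> sets borel"
    "{x. cf_digits k x \<in> A \<and> (gauss_map ^^ k) x \<in> E} \<in> sets borel"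
    using measurable_sets_borel[OF measurable_cf_digits, of A k]
      measurable_sets_borel[OF measurable_gauss_map_funpow E, of k]
    by (auto simp: vimage_def Collect_conj_eq)
  have "(\<integral>\<^sup>+x. indicator {x. cf_digits k x \<in> A \<and> (gauss_map ^^ k) x \<in> E} x \<partial>gauss_measure)
      = (\<integral>\<^sup>+x. indicator A (cf_digits k x) * indicator E ((gauss_map ^^ k) x) \<partial>gauss_measure)"
    by (intro nn_integral_cong) (auto split: split_indicator)
  also have "\<dots> = ennreal (1 / ln 2) * (\<integral>\<^sup>+u\<in>{0..<1}. moebius_integral u
      (\<lambda>x. indicator A (cf_digits k x) * indicator E ((gauss_map ^^ k) x)) \<partial>lborel)"
    by (rule gauss_measure_mixture) measurable
  also have "\<dots> \<le> ennreal (1 / ln 2) * (\<integral>\<^sup>+u. ?c * (moebius_integral u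
      (\<lambda>x. indicator A (cf_digits k x)) * indicator {0..<1} u) \<partial>lborel)"
    using moebius_integral_cylinder_le[OF E]
    by (intro mult_left_mono nn_integral_mono) (auto split: split_indicator)
  also have "\<dots> = ?c * (ennreal (1 / ln 2) * (\<integral>\<^sup>+u\<in>{0..<1}. moebius_integral u
      (\<lambda>x. indicator A (cf_digits k x)) \<partial>lborel))"
    unfolding moebius_integral_def
    by (subst nn_integral_cmult) (measurable, simp only: mult_ac)
  also have "ennreal (1 / ln 2) * (\<integral>\<^sup>+u\<in>{0..<1}. moebius_integral u
      (\<lambda>x. indicator A (cf_digits k x)) \<partial>lborel) = (\<integral>\<^sup>+x. indicator A (cf_digits k x) \<partial>gauss_measure)"
    by (rule gauss_measure_mixture[symmetric]) measurable
  also have "\<dots> = (\<integral>\<^sup>+x. indicator {x. cf_digits k x \<in> A} x \<partial>gauss_measure)"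
    by (intro nn_integral_cong) (auto split: split_indicator)
  finally show ?thesis
    by (simp only: emeasure_gauss_measure[OF E] emeasure_gauss_measure[OF \<open>{x. cf_digits k x \<in> A} \<in> sets borel\<close>]
      emeasure_gauss_measure[OF \<open>{x. cf_digits k x \<in> A \<and> (gauss_map ^^ k) x \<in> E} \<in> sets borel\<close>])
qed

lemma emeasure_gauss_map_funpow:
  assumes E [measurable]: "E \<in> sets borel"
  shows "emeasure gauss_measure ({0..<1} \<inter> {x. (gauss_map ^^ k) x \<in> E})
       = emeasure gauss_measure ({0..<1} \<inter> E)"
proof -
  have "(\<integral>\<^sup>+x. indicator E ((gauss_map ^^ k) x) \<partial>gauss_measure) = (\<integral>\<^sup>+x. indicator E x \<partial>gauss_measure)"
  proof (induction k)
    case (Suc k)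
    have "(\<integral>\<^sup>+x. indicator E ((gauss_map ^^ k) (gauss_map x)) \<partial>gauss_measure)
        = (\<integral>\<^sup>+x. indicator E ((gauss_map ^^ k) x) \<partial>gauss_measure)"
      by (rule gauss_measure_invariant) measurable
    with Suc show ?case by (simp add: funpow_swap1)
  qed simp
  moreover have "{x. (gauss_map ^^ k) x \<in> E} \<in> sets borel"
    using measurable_sets_borel[OF measurable_gauss_map_funpow E, of k] by (simp add: vimage_def)
  ultimately show ?thesis
    by (simp add: emeasure_gauss_measure indicator_def)
qed

section \<open>The past and the future of the digit sequence\<close>

lemma sigma_field_of_past:
  assumes "C \<in> sigma_field_of gauss_measure (count_space UNIV) cf_digit {1..k}"
  obtains A where "C = {0..<1} \<inter> {x. cf_digits k x \<in> A}"
proof -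
  let ?V = "vimage_algebra {0..<1} (cf_digits k) (count_space UNIV)"
  have "sigma_sets {0..<1} {cf_digit j -` A \<inter> {0..<1} | j A. j \<in> {1..k} \<and> A \<in> sets (count_space UNIV)} \<subseteq> sets ?V"
  proof (rule sets.sigma_sets_subset[of _ ?V, unfolded space_vimage_algebra], safe)
    fix j and A :: "int set" assume "j \<in> {1..k}"
    then have "cf_digit j -` A \<inter> {0..<1} = cf_digits k -` {l. l ! (j - 1) \<in> A} \<inter> {0..<1}"
      by (auto simp: cf_digits_nth)
    also have "\<dots> \<in> sets ?V" by (rule in_vimage_algebra) simp
    finally show "cf_digit j -` A \<inter> {0..<1} \<in> sets ?V" .
  qed
  then have "C \<in> sets ?V"
    using assms by (auto simp: sigma_field_of_def space_gauss_measure)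
  then obtain A where "C = cf_digits k -` A \<inter> {0..<1}"
    by (auto simp: sets_vimage_algebra2)
  then show thesis by (intro that[of A]) auto
qed

lemma cf_digit_funpow: "k < j \<Longrightarrow> cf_digit j x = cf_digit (j - k) ((gauss_map ^^ k) x)"
  unfolding cf_digit_def by (simp flip: funpow_add comp_apply[of "gauss_map ^^ _" "gauss_map ^^ _"])

lemma measurable_cf_digit_borel [measurable]: "cf_digit j \<in> measurable borel (count_space UNIV)"
  unfolding cf_digit_def by measurable

lemma sigma_field_of_future:
  assumes "D \<in> sigma_field_of gauss_measure (count_space UNIV) cf_digit {k + 1..}"
  obtains E where "E \<in> sets borel" "D = {0..<1} \<inter> {x. (gauss_map ^^ k) x \<in> E}"
proof -
  let ?V = "vimage_algebra {0..<1} (gauss_map ^^ k) borel"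
  have "sigma_sets {0..<1} {cf_digit j -` A \<inter> {0..<1} | j A. j \<in> {k + 1..} \<and> A \<in> sets (count_space UNIV)} \<subseteq> sets ?V"
  proof (rule sets.sigma_sets_subset[of _ ?V, unfolded space_vimage_algebra], safe)
    fix j and A :: "int set" assume "k + 1 \<le> j"
    then have "cf_digit j -` A \<inter> {0..<1} = (gauss_map ^^ k) -` (cf_digit (j - k) -` A) \<inter> {0..<1}"
      by (auto simp: cf_digit_funpow[of k j])
    also have "\<dots> \<in> sets ?V"
      by (intro in_vimage_algebra measurable_sets_borel[OF measurable_cf_digit_borel]) auto
    finally show "cf_digit j -` A \<inter> {0..<1} \<in> sets ?V" .
  qed
  then have "D \<in> sets ?V"
    using assms by (auto simp: sigma_field_of_def space_gauss_measure)
  then obtain E where "E \<in> sets borel" "D = (gauss_map ^^ k) -` E \<inter> {0..<1}"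
    by (auto simp: sets_vimage_algebra2)
  then show thesis by (intro that[of E]) auto
qed

lemma gauss_conditional_le:
  assumes E: "E \<in> sets borel"
    and C: "C = {0..<1} \<inter> {x. cf_digits k x \<in> A}" "0 < measure gauss_measure C"
    and D: "D = {0..<1} \<inter> {x. (gauss_map ^^ k) x \<in> E}"
  shows "\<P>(x in gauss_measure. x \<in> D \<bar> x \<in> C) - measure gauss_measure D \<le> phi_const"
proof -
  interpret prob_space gauss_measure by (rule prob_space_gauss_measure)
  have eq: "{x \<in> space gauss_measure. x \<in> D \<and> x \<in> C}
      = {0..<1} \<inter> {x. cf_digits k x \<in> A \<and> (gauss_map ^^ k) x \<in> E}"
    "{x \<in> space gauss_measure. x \<in> C} = C"
    by (auto simp: C D space_gauss_measure)
  have "ennreal (prob {x \<in> space gauss_measure. x \<in> D \<and> x \<in> C})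
      \<le> (ennreal (prob D) + ennreal phi_const) * ennreal (prob C)"
    using emeasure_gauss_cylinder_le[OF E, of k A] emeasure_gauss_map_funpow[OF E, of k]
    unfolding eq unfolding D C(1) by (simp add: emeasure_eq_measure)
  also have "\<dots> = ennreal ((prob D + phi_const) * prob C)"
    using phi_const_ge by (simp add: ennreal_mult flip: ennreal_plus)
  finally have "prob {x \<in> space gauss_measure. x \<in> D \<and> x \<in> C} \<le> (prob D + phi_const) * prob C"
    using phi_const_ge by (subst (asm) ennreal_le_iff) auto
  then show ?thesis
    unfolding cond_prob_def eq using C(2) by (simp add: pos_divide_le_eq diff_le_eq add.commute)
qed

lemma gauss_conditional_abs_le:
  assumes C: "C \<in> sigma_field_of gauss_measure (count_space UNIV) cf_digit {1..k}"
      "0 < measure gauss_measure C"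
    and D: "D \<in> sigma_field_of gauss_measure (count_space UNIV) cf_digit {k + 1..}"
  shows "\<bar>\<P>(x in gauss_measure. x \<in> D \<bar> x \<in> C) - measure gauss_measure D\<bar> \<le> phi_const"
proof -
  interpret prob_space gauss_measure by (rule prob_space_gauss_measure)
  obtain A where A: "C = {0..<1} \<inter> {x. cf_digits k x \<in> A}"
    using C(1) by (rule sigma_field_of_past)
  obtain E where E: "E \<in> sets borel" "D = {0..<1} \<inter> {x. (gauss_map ^^ k) x \<in> E}"
    using D by (rule sigma_field_of_future)
  \<comment> \<open>The upper bound for the complement of \<open>D\<close> is the lower bound for \<open>D\<close>.\<close>
  define D' where "D' = {0..<1} \<inter> {x. (gauss_map ^^ k) x \<in> - E}"
  have events: "C \<in> events" "D \<in> events"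
    using measurable_sets_borel[OF measurable_cf_digits, of A k]
      measurable_sets_borel[OF measurable_gauss_map_funpow E(1), of k]
    unfolding A E(2) by (auto simp: sets_gauss_measure sets_restrict_space vimage_def)
  have "D' = space gauss_measure - D"
    by (auto simp: D'_def E space_gauss_measure)
  then have "prob D' = 1 - prob D"
    using events by (simp add: prob_compl)
  moreover have "\<P>(x in gauss_measure. x \<in> D' \<bar> x \<in> C) = 1 - \<P>(x in gauss_measure. x \<in> D \<bar> x \<in> C)"
  proof -
    have "{x \<in> space gauss_measure. x \<in> D' \<and> x \<in> C} = C - C \<inter> D"
      "{x \<in> space gauss_measure. x \<in> D \<and> x \<in> C} = C \<inter> D" "{x \<in> space gauss_measure. x \<in> C} = C"
      by (auto simp: D'_def E A space_gauss_measure)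
    then show ?thesis
      unfolding cond_prob_def using C(2) events
      by (simp add: finite_measure_Diff diff_divide_distrib)
  qed
  ultimately have "prob D - \<P>(x in gauss_measure. x \<in> D \<bar> x \<in> C)
      = \<P>(x in gauss_measure. x \<in> D' \<bar> x \<in> C) - prob D'" by simp
  also have "\<dots> \<le> phi_const"
    using E(1) A C(2) D'_def by (intro gauss_conditional_le[of "- E"]) auto
  finally show ?thesis
    using gauss_conditional_le[OF E(1) A C(2) E(2)] by linarith
qed

section \<open>Recovering a point from its digits\<close>

text \<open>
  The \<open>n\<close>-th convergent of \<open>x\<close>. The convention \<open>1 / 0 = 0\<close> makes the recursion
  \<open>gauss_map_inverse\<close> valid at every \<open>x\<close>, so that convergence holds on all of $[0,1)$, the
  rationals included.
\<close>

primrec cf_convergent :: "nat \<Rightarrow> real \<Rightarrow> real" where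
  "cf_convergent 0 x = 0"
| "cf_convergent (Suc n) x = 1 / (of_int \<lfloor>1 / x\<rfloor> + cf_convergent n (gauss_map x))"

lemma gauss_map_bounds: "0 \<le> gauss_map x" "gauss_map x < 1"
  unfolding gauss_map_def by (auto; linarith)+

lemma gauss_map_inverse: "x = 1 / (of_int \<lfloor>1 / x\<rfloor> + gauss_map x)"
  by (simp add: gauss_map_def)

lemma one_le_floor_inverse: "0 < x \<Longrightarrow> x < 1 \<Longrightarrow> 1 \<le> \<lfloor>1 / x\<rfloor>" for x :: real
  by (simp add: le_floor_iff)

lemma cf_convergent_zero: "cf_convergent n 0 = 0"
  by (induction n) (simp_all add: gauss_map_def)

lemma cf_convergent_bounds:
  assumes "0 \<le> x" "x < 1"
  shows "0 \<le> cf_convergent n x \<and> cf_convergent n x \<le> 1"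
  using assms
proof (induction n arbitrary: x)
  case (Suc n)
  have IH: "0 \<le> cf_convergent n (gauss_map x)" using Suc.IH gauss_map_bounds by blast
  show ?case
  proof (cases "x = 0")
    case True
    then show ?thesis by (simp add: cf_convergent_zero del: cf_convergent.simps)
  next
    case False
    then have "1 \<le> real_of_int \<lfloor>1 / x\<rfloor>" using one_le_floor_inverse[of x] Suc.prems by simp
    then have "1 \<le> of_int \<lfloor>1 / x\<rfloor> + cf_convergent n (gauss_map x)" using IH by linarith
    then show ?thesis by simp
  qed
qed simp

lemma cf_convergent_error_Suc:
  assumes "0 \<le> x" "x < 1"
  shows "\<bar>x - cf_convergent (Suc n) x\<bar> \<le> x * \<bar>gauss_map x - cf_convergent n (gauss_map x)\<bar>"
proof (cases "x = 0")
  case True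
  then show ?thesis by (simp add: cf_convergent_zero gauss_map_def del: cf_convergent.simps)
next
  case False
  define a where "a = real_of_int \<lfloor>1 / x\<rfloor>"
  define c where "c = cf_convergent n (gauss_map x)"
  have a: "1 \<le> a" using False assms one_le_floor_inverse[of x] by (simp add: a_def)
  have c: "0 \<le> c" using cf_convergent_bounds gauss_map_bounds by (simp add: c_def)
  have x: "x = 1 / (a + gauss_map x)"
    using gauss_map_inverse[of x] by (simp add: a_def)
  have "x - 1 / (a + c) = 1 / (a + gauss_map x) - 1 / (a + c)" using x by simp
  also have "\<dots> = 1 / (a + gauss_map x) * ((c - gauss_map x) / (a + c))"
    using a c gauss_map_bounds[of x] by (simp add: divide_simps)
  also have "\<dots> = x * ((c - gauss_map x) / (a + c))" using x by simp
  finally have "\<bar>x - 1 / (a + c)\<bar> = x * (\<bar>gauss_map x - c\<bar> / (a + c))"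
    using assms a c by (simp add: abs_mult abs_minus_commute)
  also have "\<dots> \<le> x * \<bar>gauss_map x - c\<bar>"
  proof (intro mult_left_mono)
    show "\<bar>gauss_map x - c\<bar> / (a + c) \<le> \<bar>gauss_map x - c\<bar>"
      using a c mult_left_mono[of 1 "a + c" "\<bar>gauss_map x - c\<bar>"] by (simp add: pos_divide_le_eq)
  qed (use assms in auto)
  finally show ?thesis by (simp add: a_def c_def)
qed

lemma mult_gauss_map_le_half:
  assumes "0 \<le> x" "x < 1"
  shows "x * gauss_map x \<le> 1 / 2"
proof (cases "x = 0")
  case False
  define a where "a = real_of_int \<lfloor>1 / x\<rfloor>"
  have "1 \<le> a" using False assms one_le_floor_inverse[of x] by (simp add: a_def)
  then have "gauss_map x * 2 \<le> a + gauss_map x" using gauss_map_bounds[of x] by simp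
  moreover have "x * (a + gauss_map x) = 1"
    using False by (simp add: a_def gauss_map_def)
  ultimately have "x * (gauss_map x * 2) \<le> 1"
    using assms mult_left_mono[of "gauss_map x * 2" "a + gauss_map x" x] by simp
  then show ?thesis by simp
qed simp

text \<open>
  The error shrinks by the factor $x \cdot G x \le 1/2$ in every two steps; a single step may have
  a factor close to 1.
\<close>

lemma cf_convergent_error:
  assumes "0 \<le> x" "x < 1"
  shows "\<bar>x - cf_convergent (2 * n) x\<bar> \<le> (1 / 2) ^ n"
  using assms
proof (induction n arbitrary: x)
  case (Suc n)
  let ?y = "gauss_map x" and ?z = "gauss_map (gauss_map x)"
  have "\<bar>x - cf_convergent (2 * Suc n) x\<bar> \<le> x * \<bar>?y - cf_convergent (Suc (2 * n)) ?y\<bar>"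
    using cf_convergent_error_Suc[OF Suc.prems, of "Suc (2 * n)"] by simp
  also have "\<dots> \<le> x * (?y * \<bar>?z - cf_convergent (2 * n) ?z\<bar>)"
    using Suc.prems gauss_map_bounds by (intro mult_left_mono cf_convergent_error_Suc) auto
  also have "\<dots> = (x * ?y) * \<bar>?z - cf_convergent (2 * n) ?z\<bar>" by simp
  also have "\<dots> \<le> (1 / 2) * (1 / 2) ^ n"
    using Suc.prems gauss_map_bounds by (intro mult_mono mult_gauss_map_le_half Suc.IH) auto
  finally show ?case by simp
qed simp

lemma cf_convergent_tendsto:
  assumes "0 \<le> x" "x < 1"
  shows "(\<lambda>n. cf_convergent (2 * n) x) \<longlonglongrightarrow> x"
proof -
  have "(\<lambda>n. cf_convergent (2 * n) x - x) \<longlonglongrightarrow> 0"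
  proof (rule Lim_null_comparison)
    show "\<forall>\<^sub>F n in sequentially. norm (cf_convergent (2 * n) x - x) \<le> (1 / 2) ^ n"
      using cf_convergent_error[OF assms] by (simp add: abs_minus_commute)
    show "(\<lambda>n. (1 / 2 :: real) ^ n) \<longlonglongrightarrow> 0" by (rule LIMSEQ_realpow_zero) auto
  qed
  then show ?thesis by (simp add: LIM_zero_iff)
qed

text \<open>
  Converse of \<open>sigma_field_of_future\<close>: the digits from \<open>k + 1\<close> on generate all Borel events
  of $G^k$.
\<close>

lemma gauss_map_preimage_in_sigma_field:
  assumes E: "E \<in> sets borel"
  shows "{0..<1} \<inter> {x. (gauss_map ^^ k) x \<in> E}
    \<in> sigma_field_of gauss_measure (count_space UNIV) cf_digit {k + 1..}"
proof -
  define \<G> where "\<G> = {cf_digit j -` A \<inter> {0..<1} | j A. j \<in> {k + 1..} \<and> A \<in> sets (count_space UNIV)}"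
  define T where "T = sigma {0..<1} \<G>"
  have space_T: "space T = {0..<1}" by (simp add: T_def space_measure_of_conv)
  have sets_T: "sets T = sigma_field_of gauss_measure (count_space UNIV) cf_digit {k + 1..}"
    unfolding T_def sigma_field_of_def space_gauss_measure \<G>_def
    by (intro sets_measure_of) auto
  have digit [measurable]: "cf_digit j \<in> measurable T (count_space UNIV)" if "k + 1 \<le> j" for j
  proof (rule measurableI)
    fix A :: "int set" assume "A \<in> sets (count_space UNIV)"
    then have "cf_digit j -` A \<inter> {0..<1} \<in> \<G>" using that by (auto simp: \<G>_def)
    then show "cf_digit j -` A \<inter> space T \<in> sets T"
      unfolding space_T sets_T sigma_field_of_def space_gauss_measure \<G>_def
      by (rule sigma_sets.Basic)
  qed simp
  have conv: "(\<lambda>x. cf_convergent n ((gauss_map ^^ l) x)) \<in> borel_measurable T" if "k \<le> l" for n l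
    using that
  proof (induction n arbitrary: l)
    case (Suc n)
    have [measurable]: "(\<lambda>x. cf_convergent n ((gauss_map ^^ Suc l) x)) \<in> borel_measurable T"
      "cf_digit (Suc l) \<in> measurable T (count_space UNIV)"
      using Suc by (auto intro!: Suc.IH digit simp del: funpow.simps)
    have "(\<lambda>x. 1 / (of_int (cf_digit (Suc l) x) + cf_convergent n ((gauss_map ^^ Suc l) x))) \<in> borel_measurable T"
      by measurable
    then show ?case by (simp add: cf_digit_def)
  qed simp
  have "(gauss_map ^^ k) \<in> borel_measurable T"
  proof (rule borel_measurable_LIMSEQ_real)
    fix x assume "x \<in> space T"
    then have x: "0 \<le> x" "x < 1" by (auto simp: space_T)
    have "0 \<le> (gauss_map ^^ k) x \<and> (gauss_map ^^ k) x < 1"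
      using x gauss_map_bounds by (cases k) auto
    then show "(\<lambda>n. cf_convergent (2 * n) ((gauss_map ^^ k) x)) \<longlonglongrightarrow> (gauss_map ^^ k) x"
      by (intro cf_convergent_tendsto) auto
  qed (rule conv, simp)
  from measurable_sets[OF this E] show ?thesis
    by (simp add: space_T sets_T vimage_def Int_commute)
qed

section \<open>The extremal events\<close>

lemma measure_gauss_interval:
  assumes S [measurable]: "S \<in> sets borel" and pq: "0 \<le> p" "p \<le> q" "q \<le> 1"
    and sub: "{p<..<q} \<subseteq> S" "S \<subseteq> {p..q}"
  shows "measure gauss_measure ({0..<1} \<inter> S) = gauss_cdf q - gauss_cdf p"
proof -
  have le: "gauss_cdf p \<le> gauss_cdf q"
    using pq by (auto simp: gauss_cdf_def intro!: divide_right_mono)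
  have "emeasure gauss_measure ({0..<1} \<inter> S)
      = (\<integral>\<^sup>+x\<in>{0..<1}. indicator S x * ennreal (1 / ((x + 1) * ln 2)) \<partial>lborel)"
    by (simp add: emeasure_gauss_measure nn_integral_gauss_measure)
  also have "\<dots> = (\<integral>\<^sup>+x. ennreal (1 / ((x + 1) * ln 2)) * indicator {p..q} x \<partial>lborel)"
  proof (intro nn_integral_cong_AE AE_I'[where N = "{p, q, 1}"])
    show "{p, q, 1} \<in> null_sets lborel" by (intro countable_imp_null_set_lborel) auto
    show "{x \<in> space lborel. indicator S x * ennreal (1 / ((x + 1) * ln 2)) * indicator {0..<1} x
        \<noteq> ennreal (1 / ((x + 1) * ln 2)) * indicator {p..q} x} \<subseteq> {p, q, 1}"
    proof (intro subsetI, rule ccontr)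
      fix x assume x: "x \<in> {x \<in> space lborel. indicator S x * ennreal (1 / ((x + 1) * ln 2)) * indicator {0..<1} x
        \<noteq> ennreal (1 / ((x + 1) * ln 2)) * indicator {p..q} x}" and n: "x \<notin> {p, q, 1}"
      have "x \<in> S \<longleftrightarrow> x \<in> {p..q}" using sub n by force
      moreover have "x \<in> {p..q} \<Longrightarrow> x \<in> {0..<1}" using pq n by auto
      ultimately show False using x by (auto split: split_indicator_asm)
    qed
  qed
  also have "\<dots> = ennreal (gauss_cdf q - gauss_cdf p)"
    using pq by (intro nn_integral_FTC_Icc DERIV_gauss_cdf) auto
  finally show ?thesis using le by (simp add: measure_def)
qed

text \<open>
  The conditional probability of $\{G\omega < \xi\}$ given $\{a_1 = a\}$ tends to \<open>\<xi>\<close>.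
\<close>

lemma digit_window_limit:
  fixes \<xi> :: real
  assumes "0 < \<xi>" "\<xi> < 1"
  shows "(\<lambda>a. (gauss_cdf (1 / real a) - gauss_cdf (1 / (real a + \<xi>))) /
      (gauss_cdf (1 / real a) - gauss_cdf (1 / (real a + 1)))) \<longlonglongrightarrow> \<xi>"
proof -
  have "(\<lambda>a. (ln (1 + 1 / real a) - ln (1 + 1 / (real a + \<xi>))) /
      (ln (1 + 1 / real a) - ln (1 + 1 / (real a + 1)))) \<longlonglongrightarrow> \<xi>"
    using assms by real_asymp
  then show ?thesis
    unfolding gauss_cdf_def by (simp flip: diff_divide_distrib)
qed

lemma phi_const_eq: "phi_const = gauss_cdf (1 / ln 2 - 1) - (1 / ln 2 - 1)"
proof -
  have "ln (1 / ln 2) = - ln (ln 2 :: real)" by (simp add: ln_div)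
  then show ?thesis
    unfolding phi_const_def gauss_cdf_def by (simp add: diff_divide_distrib add_divide_distrib)
qed

lemma gauss_phi_dep_bounds:
  fixes k :: nat
  defines "\<C> \<equiv> sigma_field_of gauss_measure (count_space UNIV) cf_digit {1..k}"
    and "\<D> \<equiv> sigma_field_of gauss_measure (count_space UNIV) cf_digit {k + 1..}"
  shows "phi_dep gauss_measure \<C> \<D> \<le> phi_const"
    and "\<lbrakk>C \<in> \<C>; D \<in> \<D>; 0 < measure gauss_measure C\<rbrakk> \<Longrightarrow>
      \<bar>\<P>(x in gauss_measure. x \<in> D \<bar> x \<in> C) - measure gauss_measure D\<bar> \<le> phi_dep gauss_measure \<C> \<D>"
proof -
  interpret prob_space gauss_measure by (rule prob_space_gauss_measure)
  let ?S = "{\<bar>\<P>(x in gauss_measure. x \<in> D \<bar> x \<in> C) - measure gauss_measure D\<bar> | C D.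
      C \<in> \<C> \<and> D \<in> \<D> \<and> measure gauss_measure C > 0}"
  have "space gauss_measure \<in> \<C>" "{} \<in> \<D>"
    unfolding \<C>_def \<D>_def sigma_field_of_def
    by (rule sigma_sets_top, rule sigma_sets.Empty)
  moreover have "0 < prob (space gauss_measure)" using prob_space by simp
  ultimately have ne: "?S \<noteq> {}" by blast
  have ub: "s \<le> phi_const" if "s \<in> ?S" for s
    using that gauss_conditional_abs_le unfolding \<C>_def \<D>_def by blast
  show "phi_dep gauss_measure \<C> \<D> \<le> phi_const"
    unfolding phi_dep_def by (rule cSup_least[OF ne ub])
  show "\<bar>\<P>(x in gauss_measure. x \<in> D \<bar> x \<in> C) - measure gauss_measure D\<bar> \<le> phi_dep gauss_measure \<C> \<D>"
    if "C \<in> \<C>" "D \<in> \<D>" "0 < measure gauss_measure C"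
    unfolding phi_dep_def using that ub by (intro cSup_upper bdd_aboveI[of _ phi_const]) blast+
qed

lemma phi_const_le_phi_dep:
  "phi_const \<le> phi_dep gauss_measure
     (sigma_field_of gauss_measure (count_space UNIV) cf_digit {1..1})
     (sigma_field_of gauss_measure (count_space UNIV) cf_digit {1 + 1..})" (is "_ \<le> ?phi")
proof -
  interpret prob_space gauss_measure by (rule prob_space_gauss_measure)
  define \<xi> :: real where "\<xi> = 1 / ln 2 - 1"
  have \<xi>: "0 < \<xi>" "\<xi> < 1"
    using ln2_ge_two_thirds ln2_le_25_over_36 by (auto simp: \<xi>_def field_simps)
  define C where "C a = {0..<1} \<inter> {x. cf_digit 1 x = int a}" for a
  define D where "D = {0..<1} \<inter> {x. (gauss_map ^^ 1) x \<in> {0..<\<xi>}}"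
  have C_in: "C a \<in> sigma_field_of gauss_measure (count_space UNIV) cf_digit {1..1}" for a
    unfolding sigma_field_of_def space_gauss_measure
    by (rule sigma_sets.Basic) (auto simp: C_def intro!: exI[of _ 1] exI[of _ "{int a}"])
  have D_in: "D \<in> sigma_field_of gauss_measure (count_space UNIV) cf_digit {1 + 1..}"
    unfolding D_def by (rule gauss_map_preimage_in_sigma_field) auto
  have "prob D = prob ({0..<1} \<inter> {0..<\<xi>})"
    unfolding D_def measure_def by (subst emeasure_gauss_map_funpow) auto
  also have "\<dots> = gauss_cdf \<xi> - gauss_cdf 0"
    using \<xi> by (intro measure_gauss_interval) auto
  finally have prob_D: "prob D = gauss_cdf \<xi>" by (simp add: gauss_cdf_def)
  have digit_iff: "cf_digit 1 x = int a \<longleftrightarrow> x \<in> {1 / (real a + 1)<..1 / real a}"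
    if "2 \<le> a" "0 \<le> x" for a x
    using that by (cases "x = 0") (auto simp: cf_digit_def floor_eq_iff field_simps)
  have prob_C: "prob (C a) = gauss_cdf (1 / real a) - gauss_cdf (1 / (real a + 1))" if a: "2 \<le> a" for a
  proof -
    have "C a = {0..<1} \<inter> {1 / (real a + 1)<..1 / real a}"
      using digit_iff[OF a] by (auto simp: C_def)
    also have "prob \<dots> = gauss_cdf (1 / real a) - gauss_cdf (1 / (real a + 1))"
      using a by (intro measure_gauss_interval) (auto simp: field_simps)
    finally show ?thesis .
  qed
  have prob_DC: "prob (D \<inter> C a) = gauss_cdf (1 / real a) - gauss_cdf (1 / (real a + \<xi>))" if a: "2 \<le> a" for a
  proof -
    have "x \<in> D \<longleftrightarrow> 1 / (real a + \<xi>) < x" if x: "x \<in> C a" for x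
    proof -
      have dig: "\<lfloor>1 / x\<rfloor> = int a" "0 \<le> x" "x < 1" using x by (auto simp: C_def cf_digit_def)
      then have "x \<noteq> 0" using a by (cases "x = 0") auto
      then have "gauss_map x < \<xi> \<longleftrightarrow> 1 / x < real a + \<xi>" using dig by (auto simp: gauss_map_def)
      also have "\<dots> \<longleftrightarrow> 1 / (real a + \<xi>) < x"
        using \<open>x \<noteq> 0\<close> dig \<xi> by (simp add: field_simps)
      finally show ?thesis using dig gauss_map_bounds[of x] by (auto simp: D_def)
    qed
    moreover have "1 / (real a + 1) < 1 / (real a + \<xi>)"
      using a \<xi> by (simp add: frac_less2)
    ultimately have "D \<inter> C a = {0..<1} \<inter> {1 / (real a + \<xi>)<..1 / real a}"
      using digit_iff[OF a] unfolding C_def by force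
    also have "prob \<dots> = gauss_cdf (1 / real a) - gauss_cdf (1 / (real a + \<xi>))"
      using a \<xi> by (intro measure_gauss_interval) (auto simp: field_simps)
    finally show ?thesis .
  qed
  have "(\<lambda>a. \<bar>(gauss_cdf (1 / real a) - gauss_cdf (1 / (real a + \<xi>))) /
      (gauss_cdf (1 / real a) - gauss_cdf (1 / (real a + 1))) - gauss_cdf \<xi>\<bar>) \<longlonglongrightarrow> \<bar>\<xi> - gauss_cdf \<xi>\<bar>"
    by (intro tendsto_intros digit_window_limit \<xi>)
  moreover have "\<bar>(gauss_cdf (1 / real a) - gauss_cdf (1 / (real a + \<xi>))) /
      (gauss_cdf (1 / real a) - gauss_cdf (1 / (real a + 1))) - gauss_cdf \<xi>\<bar> \<le> ?phi" if a: "2 \<le> a" for a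
  proof -
    have "1 / (real a + 1) < 1 / real a" using a by (simp add: frac_less2)
    then have "0 < prob (C a)"
      unfolding prob_C[OF a] gauss_cdf_def using a
      by (simp add: divide_less_cancel add_pos_nonneg)
    from gauss_phi_dep_bounds(2)[OF C_in D_in this]
    have "\<bar>\<P>(x in gauss_measure. x \<in> D \<bar> x \<in> C a) - prob D\<bar> \<le> ?phi" .
    moreover have "{x \<in> space gauss_measure. x \<in> D \<and> x \<in> C a} = D \<inter> C a"
      "{x \<in> space gauss_measure. x \<in> C a} = C a"
      by (auto simp: C_def D_def space_gauss_measure)
    ultimately show ?thesis
      unfolding cond_prob_def by (simp add: prob_C[OF a] prob_DC[OF a] prob_D)
  qed
  ultimately have "\<bar>\<xi> - gauss_cdf \<xi>\<bar> \<le> ?phi"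
    by (intro LIMSEQ_le_const2) auto
  then show ?thesis
    unfolding phi_const_eq \<xi>_def by linarith
qed

theorem lemma2p3:
  shows "phi_gauss 1 = - ((1 - ln 2 + ln (ln 2)) / ln 2) \<and>
    - ((1 - ln 2 + ln (ln 2)) / ln 2) < (0.0861 :: real)"
proof -
  let ?phi = "\<lambda>k. phi_dep gauss_measure
     (sigma_field_of gauss_measure (count_space UNIV) cf_digit {1..k})
     (sigma_field_of gauss_measure (count_space UNIV) cf_digit {k + 1..})"
  have "phi_gauss 1 = (SUP k\<in>{1..}. ?phi k)"
    by (simp only: phi_gauss_def phi_mixing_def)
  also have "\<dots> = phi_const"
  proof (rule antisym)
    show "(SUP k\<in>{1..}. ?phi k) \<le> phi_const"
      by (rule cSUP_least) (use gauss_phi_dep_bounds(1) in auto)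
    have "phi_const \<le> ?phi 1" by (rule phi_const_le_phi_dep)
    also have "\<dots> \<le> (SUP k\<in>{1..}. ?phi k)"
      by (rule cSUP_upper) (use gauss_phi_dep_bounds(1) in \<open>auto intro!: bdd_aboveI[of _ phi_const]\<close>)
    finally show "phi_const \<le> (SUP k\<in>{1..}. ?phi k)" .
  qed
  finally show ?thesis
    using phi_const_less by (simp add: phi_const_def)
qed
end
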